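(* Let $n\ge 1$ be an integer. A finite metric tree with more than $2n$ leaves cannot be embedded isometrically into $(\mathbb{R}^n,d_1)$.
   Context: Finite metric tree: take a finite connected graph without cycles (a finite tree in the sense of graph theory) whose edges carry positive real weights and which has no vertex of degree 2. The finite metric tree is the metric space consisting of all points of the geometric realization of this graph, where each edge is identified with a closed interval whose length is the weight of the edge. The distance between two vertices is the total weight of the unique simple path joining them, and the distance between two arbitrary points (possibly interior to edges) is the length of the unique simple path joining them, taking into account the corresponding portions of the edges carrying these points. A leaf is a vertex of degree 1. The metric $d_1$ on $\mathbb{R}^n$ is $d_1(x,y)=\sum_{i=1}^n|x_i-y_i|$. An isometric embedding is a distance-preserving map (not necessarily surjective) defined on the whole metric tree (all points, not only vertices). *)

theory Defs
  imports "HOL-Analysis.Analysis"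
begin

text \<open>Finite simple graphs are given by a vertex set \<open>V\<close> and a set \<open>E\<close> of two-element subsets
  of \<open>V\<close>.\<close>

definition is_walk :: "'v set \<Rightarrow> 'v set set \<Rightarrow> 'v list \<Rightarrow> bool" where
  "is_walk V E vs \<longleftrightarrow> vs \<noteq> [] \<and> set vs \<subseteq> V \<and> successively (\<lambda>u v. {u, v} \<in> E) vs"

definition is_cycle :: "'v set \<Rightarrow> 'v set set \<Rightarrow> 'v list \<Rightarrow> bool" where
  "is_cycle V E vs \<longleftrightarrow>
     is_walk V E vs \<and> distinct vs \<and> 3 \<le> length vs \<and> {last vs, hd vs} \<in> E"

definition degree :: "'v set set \<Rightarrow> 'v \<Rightarrow> nat" where
  "degree E v = card {e \<in> E. v \<in> e}"

definition leaves :: "'v set \<Rightarrow> 'v set set \<Rightarrow> 'v set" where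
  "leaves V E = {v \<in> V. degree E v = 1}"

locale finite_weighted_tree =
  fixes V :: "'v set" and E :: "'v set set" and w :: "'v set \<Rightarrow> real"
  assumes finite_V: "finite V"
    and V_nonempty: "V \<noteq> {}"
    and edges: "\<And>e. e \<in> E \<Longrightarrow> e \<subseteq> V \<and> card e = 2"
    and connected: "\<And>u v. u \<in> V \<Longrightarrow> v \<in> V \<Longrightarrow> \<exists>vs. is_walk V E vs \<and> hd vs = u \<and> last vs = v"
    and acyclic: "\<nexists>vs. is_cycle V E vs"
    and weight_pos: "\<And>e. e \<in> E \<Longrightarrow> 0 < w e"
    and no_degree_2: "\<And>v. v \<in> V \<Longrightarrow> degree E v \<noteq> 2"

text \<open>Points of the geometric realization are given by barycentric coordinates with respect to
  the vertices. The closed edge \<open>e = {u, v}\<close> is \<open>cell e\<close>; it is identified with the interval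
  \<open>{0..w e}\<close> by \<open>p \<mapsto> w e * p v\<close>, and a vertex \<open>v\<close> is the point \<open>indicator {v}\<close>, which makes
  the gluing of edges at common vertices automatic. The cells \<open>cell {v}\<close> are needed only for
  the one-vertex tree.\<close>

definition cell :: "'v set \<Rightarrow> ('v \<Rightarrow> real) set" where
  "cell s = {p. (\<forall>v. 0 \<le> p v) \<and> (\<forall>v. v \<notin> s \<longrightarrow> p v = 0) \<and> (\<Sum>v\<in>s. p v) = 1}"

definition realization :: "'v set \<Rightarrow> 'v set set \<Rightarrow> ('v \<Rightarrow> real) set" where
  "realization V E = (\<Union>e\<in>E. cell e) \<union> (\<Union>v\<in>V. cell {v})"

definition segment :: "('v \<Rightarrow> real) \<Rightarrow> ('v \<Rightarrow> real) \<Rightarrow> ('v \<Rightarrow> real) set" where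
  "segment p q = {(\<lambda>v. (1 - t) * p v + t * q v) | t. t \<in> {0..1}}"

text \<open>Length of the portion of \<open>e = {u, v}\<close> between two of its points. Both summands below equal
  \<open>\<bar>p v - q v\<bar>\<close>, so this is \<open>\<bar>w e * p v - w e * q v\<bar>\<close>.\<close>

definition edge_length :: "('v set \<Rightarrow> real) \<Rightarrow> 'v set \<Rightarrow> ('v \<Rightarrow> real) \<Rightarrow> ('v \<Rightarrow> real) \<Rightarrow> real" where
  "edge_length w e p q = w e * ((\<Sum>v\<in>e. \<bar>p v - q v\<bar>) / 2)"

text \<open>A simple path from \<open>p\<close> to \<open>q\<close> is given by its successive breakpoints \<open>ps\<close> and the edges
  \<open>es\<close> carrying its pieces: the \<open>i\<close>-th piece is a nondegenerate segment of the edge \<open>es ! i\<close>,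
  the path changes edge only at vertices, and the pieces do not meet except that consecutive ones
  share their common breakpoint, so that the path does not cross or retrace itself. If \<open>p = q\<close>
  the path has no pieces.\<close>

definition is_simple_path ::
  "'v set \<Rightarrow> 'v set set \<Rightarrow> ('v \<Rightarrow> real) \<Rightarrow> ('v \<Rightarrow> real) \<Rightarrow> ('v \<Rightarrow> real) list \<Rightarrow> 'v set list \<Rightarrow> bool"
  where
  "is_simple_path V E p q ps es \<longleftrightarrow>
     set ps \<subseteq> realization V E \<and> length ps = Suc (length es) \<and> hd ps = p \<and> last ps = q \<and>
     (\<forall>i < length es. es ! i \<in> E \<and> ps ! i \<in> cell (es ! i) \<and> ps ! Suc i \<in> cell (es ! i) \<and>
        ps ! i \<noteq> ps ! Suc i) \<and>
     (\<forall>i. 0 < i \<and> i < length es \<longrightarrow> (\<exists>v\<in>V. ps ! i = indicator {v})) \<and>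
     (\<forall>i j. i < j \<and> j < length es \<longrightarrow>
        segment (ps ! i) (ps ! Suc i) \<inter> segment (ps ! j) (ps ! Suc j)
          = (if j = Suc i then {ps ! j} else {}))"

definition path_length ::
  "('v set \<Rightarrow> real) \<Rightarrow> ('v \<Rightarrow> real) list \<Rightarrow> 'v set list \<Rightarrow> real" where
  "path_length w ps es = (\<Sum>i<length es. edge_length w (es ! i) (ps ! i) (ps ! Suc i))"

text \<open>In a tree the simple path between two points of the realization exists and is unique.\<close>

definition tree_dist ::
  "'v set \<Rightarrow> 'v set set \<Rightarrow> ('v set \<Rightarrow> real) \<Rightarrow> ('v \<Rightarrow> real) \<Rightarrow> ('v \<Rightarrow> real) \<Rightarrow> real" where
  "tree_dist V E w p q = (THE l. \<exists>ps es. is_simple_path V E p q ps es \<and> l = path_length w ps es)"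

definition d1 :: "real ^ 'n \<Rightarrow> real ^ 'n \<Rightarrow> real" where
  "d1 x y = (\<Sum>i\<in>UNIV. \<bar>x $ i - y $ i\<bar>)"

definition isometric_embedding_on ::
  "'a set \<Rightarrow> ('a \<Rightarrow> 'a \<Rightarrow> real) \<Rightarrow> ('b \<Rightarrow> 'b \<Rightarrow> real) \<Rightarrow> ('a \<Rightarrow> 'b) \<Rightarrow> bool" where
  "isometric_embedding_on S d d' f \<longleftrightarrow> (\<forall>x\<in>S. \<forall>y\<in>S. d' (f x) (f y) = d x y)"

end

theory Submission
  imports Defs
begin

text \<open>Let \<open>f\<close> be an isometric embedding. Each leaf \<open>u\<close>, with its unique neighbour \<open>a\<close>, has
  positive distance to \<open>a\<close>, so some coordinate of \<open>f\<close> changes on the pendant edge. Label \<open>u\<close> by one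
  such coordinate \<open>i\<close> together with the sign of the change. There are only \<open>2 * n\<close> labels, so it
  suffices that distinct leaves \<open>u\<close> and \<open>v\<close>, with neighbours \<open>a\<close> and \<open>b\<close>, get distinct labels.

  This holds because geodesics of \<open>d1\<close> are monotone in every coordinate. The path from \<open>u\<close> to \<open>v\<close>
  passes through \<open>a\<close> and then \<open>b\<close>, so the distances between \<open>u\<close>, \<open>a\<close>, \<open>b\<close>, \<open>v\<close> add up (lemma
  \<open>dist_between_leaves\<close>). The triangle inequality is then an equality in each coordinate separately
  (lemma \<open>d1_additive_coordinatewise\<close>), and \<open>f\<close> cannot first move one way from \<open>u\<close> to \<open>a\<close> and
  finally the opposite way from \<open>b\<close> to \<open>v\<close> in the same coordinate. But equal labels mean exactly this.

  Only distances between vertices enter the argument. The combinatorial part therefore consists of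
  reducing \<open>tree_dist\<close> between vertices to the total weight of a walk without repeated vertices
  (lemma \<open>tree_dist_eq_walk_length\<close>), which rests on uniqueness of such walks in an acyclic graph
  (lemma \<open>distinct_walk_unique\<close>).\<close>

section \<open>Walks without repeated vertices\<close>

lemma distinct_walk_exists:
  assumes "is_walk V E vs"
  shows "\<exists>xs. is_walk V E xs \<and> distinct xs \<and> hd xs = hd vs \<and> last xs = last vs"
  using assms
proof (induction vs rule: length_induct)
  case (1 vs)
  show ?case
  proof (cases "distinct vs")
    case False
    then obtain as bs cs y where vs: "vs = as @ [y] @ bs @ [y] @ cs"
      using not_distinct_decomp by blast
    \<comment> \<open>Cutting out the closed detour at \<open>y\<close> keeps both ends.\<close>
    have "is_walk V E (as @ [y] @ cs)"
      using "1.prems" unfolding vs is_walk_def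
      by (auto simp: successively_append_iff successively_Cons)
    moreover have "length (as @ [y] @ cs) < length vs" by (simp add: vs)
    moreover have "hd (as @ [y] @ cs) = hd vs" "last (as @ [y] @ cs) = last vs"
      by (simp_all add: vs hd_append)
    ultimately show ?thesis using "1.IH" by metis
  qed (use "1.prems" in blast)
qed

lemma is_walk_ConsD:
  "is_walk V E (x # xs) \<Longrightarrow> xs \<noteq> [] \<Longrightarrow> is_walk V E xs \<and> {x, hd xs} \<in> E"
  by (cases xs) (auto simp: is_walk_def)

text \<open>Two paths that leave \<open>u\<close> through different neighbours and meet again bound a cycle: follow
  the first one up to its first vertex \<open>z\<close> on the second one, and return along the second one.\<close>

lemma cycle_from_diverging_walks:
  assumes xs: "is_walk V E (u # xs)" "distinct (u # xs)"
    and ys: "is_walk V E (u # ys)" "distinct (u # ys)"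
    and meet: "set xs \<inter> set ys \<noteq> {}" and div: "hd xs \<noteq> hd ys"
  shows "\<exists>vs. is_cycle V E vs"
proof -
  obtain P z R where P: "xs = P @ z # R" "z \<in> set ys" "\<forall>x \<in> set P. x \<notin> set ys"
    using meet split_list_first_prop[of xs "\<lambda>x. x \<in> set ys"] by blast
  obtain Q S where Q: "ys = Q @ z # S"
    using P(2) split_list by metis
  let ?c = "u # P @ z # rev Q"
  have PQ: "P \<noteq> [] \<or> Q \<noteq> []" using div by (auto simp: P(1) Q)
  have sym: "successively (\<lambda>x y. {x, y} \<in> E) (rev zs) = successively (\<lambda>x y. {x, y} \<in> E) zs" for zs
    by (simp add: successively_rev insert_commute)
  have sx: "successively (\<lambda>x y. {x, y} \<in> E) (u # P @ [z])"
    using xs(1) unfolding is_walk_def P(1)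
    by (auto simp: successively_append_iff successively_Cons hd_append)
  have sy: "successively (\<lambda>x y. {x, y} \<in> E) (u # Q @ [z])"
    using ys(1) unfolding is_walk_def Q
    by (auto simp: successively_append_iff successively_Cons hd_append)
  then have "successively (\<lambda>x y. {x, y} \<in> E) (Q @ [z])"
    by (auto simp: successively_Cons)
  from this[folded sym[of "Q @ [z]"]] have "successively (\<lambda>x y. {x, y} \<in> E) (z # rev Q)"
    by simp
  with sx have "successively (\<lambda>x y. {x, y} \<in> E) ((u # P @ [z]) @ rev Q)"
    unfolding successively_append_iff[of _ "u # P @ [z]" "rev Q"]
    by (auto simp: successively_Cons)
  then have "successively (\<lambda>x y. {x, y} \<in> E) ?c" by simp
  moreover have "set ?c \<subseteq> V" using xs(1) ys(1) by (auto simp: is_walk_def P(1) Q)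
  moreover have "distinct ?c" using xs(2) ys(2) P(3) by (auto simp: P(1) Q)
  moreover have "3 \<le> length ?c" using PQ by (cases P; cases Q) auto
  moreover have "{last ?c, hd ?c} \<in> E"
    using sy by (cases Q) (auto simp: insert_commute)
  ultimately show ?thesis unfolding is_cycle_def is_walk_def by blast
qed

lemma distinct_walk_unique:
  assumes acyclic: "\<nexists>vs. is_cycle V E vs"
    and "is_walk V E xs" "distinct xs" "is_walk V E ys" "distinct ys"
    and "hd xs = hd ys" "last xs = last ys"
  shows "xs = ys"
  using assms(2-)
proof (induction xs arbitrary: ys)
  case Nil
  then show ?case by (simp add: is_walk_def)
next
  case (Cons u xs)
  from Cons.prems obtain ys' where ys: "ys = u # ys'"
    by (cases ys) (auto simp: is_walk_def)
  show ?case
  proof (cases "xs = [] \<or> ys' = []")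
    case True
    \<comment> \<open>A walk without repetitions that ends where it starts is a single vertex.\<close>
    then show ?thesis
      using Cons.prems unfolding ys
      by (auto split: if_splits dest: last_in_set)
  next
    case False
    have "last xs \<in> set xs \<inter> set ys'"
      using False Cons.prems(6) last_in_set[of xs] last_in_set[of ys'] by (simp add: ys)
    then have "hd xs = hd ys'"
      using cycle_from_diverging_walks[of V E u xs ys'] Cons.prems acyclic unfolding ys by blast
    then show ?thesis
      using Cons.IH[of ys'] Cons.prems False is_walk_ConsD[of V E u]
      unfolding ys by auto
  qed
qed

fun walk_length :: "('v set \<Rightarrow> real) \<Rightarrow> 'v list \<Rightarrow> real" where
  "walk_length w (x # y # zs) = w {x, y} + walk_length w (y # zs)"
| "walk_length w _ = 0"

lemma walk_length_Cons:
  "xs \<noteq> [] \<Longrightarrow> walk_length w (x # xs) = w {x, hd xs} + walk_length w xs"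
  by (cases xs) auto

lemma walk_length_snoc:
  "xs \<noteq> [] \<Longrightarrow> walk_length w (xs @ [y]) = walk_length w xs + w {last xs, y}"
  by (induction w xs rule: walk_length.induct) auto

lemma walk_length_eq_sum:
  "walk_length w xs = (\<Sum>i<length xs - 1. w {xs ! i, xs ! Suc i})"
  by (induction w xs rule: walk_length.induct) (auto simp: sum.lessThan_Suc_shift simp del: sum.lessThan_Suc)

section \<open>Simple paths between vertices\<close>

lemma indicator_in_cell_iff:
  assumes "finite s"
  shows "(indicator {x} :: 'v \<Rightarrow> real) \<in> cell s \<longleftrightarrow> x \<in> s"
proof
  assume "(indicator {x} :: 'v \<Rightarrow> real) \<in> cell s"
  then have "x \<notin> s \<longrightarrow> indicator {x} x = (0::real)" unfolding cell_def by blast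
  then show "x \<in> s" by (simp add: indicator_def)
next
  assume "x \<in> s"
  moreover have "(\<Sum>v\<in>s. indicator {x} v) = (1::real)"
    using assms \<open>x \<in> s\<close> by (simp add: indicator_def sum.delta)
  ultimately show "(indicator {x} :: 'v \<Rightarrow> real) \<in> cell s"
    by (auto simp: cell_def indicator_def)
qed

lemma vertex_in_realization:
  "x \<in> V \<Longrightarrow> (indicator {x} :: 'v \<Rightarrow> real) \<in> realization V E"
  using indicator_in_cell_iff[of "{x}" x] unfolding realization_def by auto

lemma indicator_singleton_eq_iff:
  "(indicator {x} :: 'v \<Rightarrow> real) = indicator {y} \<longleftrightarrow> x = y"
  by (auto simp: fun_eq_iff indicator_def split: if_splits)

lemma ends_in_segment: "p \<in> segment p q" "q \<in> segment p q"
proof -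
  show "p \<in> segment p q" unfolding segment_def
    by (rule CollectI, rule exI[of _ 0]) auto
  show "q \<in> segment p q" unfolding segment_def
    by (rule CollectI, rule exI[of _ 1]) auto
qed

lemma edge_length_ends:
  "a \<noteq> b \<Longrightarrow> edge_length w {a, b} (indicator {a}) (indicator {b}) = w {a, b}"
  by (simp add: edge_length_def)

text \<open>Points of an edge are supported on its two ends, and their coordinates sum to 1. So the
  segments of two edges without common end are disjoint, and two edges with one common end meet
  in that end only.\<close>

lemma segment_disjoint_edges:
  assumes "{a, b} \<inter> {c, d} = {}"
  shows "segment (indicator {a}) (indicator {b}) \<inter> segment (indicator {c}) (indicator {d})
    = ({} :: ('v \<Rightarrow> real) set)"
proof -
  have False
    if p: "p \<in> segment (indicator {a}) (indicator {b})"
      "p \<in> segment (indicator {c}) (indicator {d})" for p :: "'v \<Rightarrow> real"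
  proof -
    obtain t where t: "p = (\<lambda>v. (1 - t) * indicator {a} v + t * indicator {b} v)"
      using p(1) unfolding segment_def by blast
    obtain s where s: "p = (\<lambda>v. (1 - s) * indicator {c} v + s * indicator {d} v)"
      using p(2) unfolding segment_def by blast
    have "p a = 0" "p b = 0" unfolding s using assms by (auto simp: indicator_def)
    then show False unfolding t by (cases "a = b") (auto simp: indicator_def)
  qed
  then show ?thesis by blast
qed

lemma segment_adjacent_edges:
  assumes "a \<noteq> b" "b \<noteq> d" "a \<noteq> d"
  shows "segment (indicator {a}) (indicator {b}) \<inter> segment (indicator {b}) (indicator {d})
    = {indicator {b} :: 'v \<Rightarrow> real}"
proof -
  have "p = indicator {b}"
    if p: "p \<in> segment (indicator {a}) (indicator {b})"
      "p \<in> segment (indicator {b}) (indicator {d})" for p :: "'v \<Rightarrow> real"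
  proof -
    obtain t where t: "p = (\<lambda>v. (1 - t) * indicator {a} v + t * indicator {b} v)"
      using p(1) unfolding segment_def by blast
    obtain s where s: "p = (\<lambda>v. (1 - s) * indicator {b} v + s * indicator {d} v)"
      using p(2) unfolding segment_def by blast
    have "p a = 0" unfolding s using assms by (auto simp: indicator_def)
    then have "t = 1" unfolding t using assms by (auto simp: indicator_def)
    then show ?thesis unfolding t by simp
  qed
  then show ?thesis using ends_in_segment by blast
qed

context finite_weighted_tree
begin

lemma edge_ends:
  assumes "{x, y} \<in> E"
  shows "x \<noteq> y" "x \<in> V" "y \<in> V"
  using edges[OF assms] by auto

lemma edge_eq_ends:
  assumes "e \<in> E" "x \<in> e" "y \<in> e" "x \<noteq> y"
  shows "e = {x, y}"
  using edges[OF assms(1)] assms(2-) by (auto simp: card_2_iff)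

lemma distinct_walk_is_simple_path:
  assumes "is_walk V E xs" "distinct xs"
  defines "ps \<equiv> map (\<lambda>x. indicator {x} :: 'v \<Rightarrow> real) xs"
    and "es \<equiv> map (\<lambda>i. {xs ! i, xs ! Suc i}) [0..<length xs - 1]"
  shows "is_simple_path V E (indicator {hd xs}) (indicator {last xs}) ps es"
    and "path_length w ps es = walk_length w xs"
proof -
  have ne: "xs \<noteq> []" and sub: "set xs \<subseteq> V" and
    edge: "\<And>i. Suc i < length xs \<Longrightarrow> {xs ! i, xs ! Suc i} \<in> E"
    using assms(1) unfolding is_walk_def by (auto simp: successively_conv_nth)
  have V: "xs ! i \<in> V" if "i < length xs" for i
    using sub that by auto
  have neq: "xs ! i \<noteq> xs ! j" if "i < length xs" "j < length xs" "i \<noteq> j" for i j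
    using assms(2) that by (simp add: nth_eq_iff_index_eq)
  have inter: "segment (ps ! i) (ps ! Suc i) \<inter> segment (ps ! j) (ps ! Suc j)
          = (if j = Suc i then {ps ! j} else {})" if "i < j" "j < length es" for i j
  proof (cases "j = Suc i")
    case True
    then show ?thesis
      using segment_adjacent_edges[of "xs ! i" "xs ! Suc i" "xs ! Suc (Suc i)"] that neq
      by (auto simp: ps_def es_def)
  next
    case False
    have "{xs ! i, xs ! Suc i} \<inter> {xs ! j, xs ! Suc j} = {}"
      using that False by (auto simp: es_def neq)
    with segment_disjoint_edges[OF this] False that show ?thesis
      by (simp add: ps_def es_def)
  qed
  show "is_simple_path V E (indicator {hd xs}) (indicator {last xs}) ps es"
    unfolding is_simple_path_def
  proof (intro conjI)
    show "set ps \<subseteq> realization V E"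
      using sub by (auto simp: ps_def intro!: vertex_in_realization)
    show "length ps = Suc (length es)" using ne by (simp add: ps_def es_def)
    show "hd ps = indicator {hd xs}" "last ps = indicator {last xs}"
      using ne by (simp_all add: ps_def hd_map last_map)
    show "\<forall>i<length es. es ! i \<in> E \<and> ps ! i \<in> cell (es ! i) \<and> ps ! Suc i \<in> cell (es ! i)
      \<and> ps ! i \<noteq> ps ! Suc i"
      using edge neq
      by (simp add: ps_def es_def indicator_in_cell_iff indicator_singleton_eq_iff)
    show "\<forall>i. 0 < i \<and> i < length es \<longrightarrow> (\<exists>v\<in>V. ps ! i = indicator {v})"
    proof (intro allI impI)
      fix i assume "0 < i \<and> i < length es"
      then have "i < length xs" by (auto simp: es_def)
      then show "\<exists>v\<in>V. ps ! i = indicator {v}"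
        using V by (intro bexI[of _ "xs ! i"]) (simp_all add: ps_def)
    qed
    show "\<forall>i j. i < j \<and> j < length es \<longrightarrow>
        segment (ps ! i) (ps ! Suc i) \<inter> segment (ps ! j) (ps ! Suc j)
          = (if j = Suc i then {ps ! j} else {})"
      using inter by blast
  qed
  show "path_length w ps es = walk_length w xs"
    unfolding walk_length_eq_sum path_length_def
    by (auto simp: ps_def es_def edge_length_ends neq intro!: sum.cong)
qed

text \<open>A simple path may change edge only at vertices, so one that starts and ends at vertices
  has only vertices as breakpoints; it does not visit any of them twice because its pieces do not
  meet again.\<close>

lemma simple_path_between_vertices:
  assumes sp: "is_simple_path V E (indicator {u}) (indicator {v}) ps es"
    and uv: "u \<in> V" "v \<in> V"
  shows "\<exists>xs. is_walk V E xs \<and> distinct xs \<and> hd xs = u \<and> last xs = v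
           \<and> path_length w ps es = walk_length w xs"
proof -
  have len: "length ps = Suc (length es)" and hd: "hd ps = indicator {u}"
    and last: "last ps = indicator {v}"
    and pieces: "\<And>i. i < length es \<Longrightarrow> es ! i \<in> E \<and> ps ! i \<in> cell (es ! i)
        \<and> ps ! Suc i \<in> cell (es ! i) \<and> ps ! i \<noteq> ps ! Suc i"
    and mid: "\<And>i. 0 < i \<Longrightarrow> i < length es \<Longrightarrow> \<exists>v\<in>V. ps ! i = indicator {v}"
    and inter: "\<And>i j. i < j \<Longrightarrow> j < length es \<Longrightarrow>
        segment (ps ! i) (ps ! Suc i) \<inter> segment (ps ! j) (ps ! Suc j)
          = (if j = Suc i then {ps ! j} else {})"
    using sp unfolding is_simple_path_def by blast+
  have "\<exists>x\<in>V. ps ! i = indicator {x}" if "i < length ps" for i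
  proof -
    have "i = 0 \<or> 0 < i \<and> i < length es \<or> i = length es" using that len by linarith
    then consider "i = 0" | "0 < i" "i < length es" | "i = length es" by blast
    then show ?thesis
    proof cases
      case 1
      then show ?thesis using hd len uv hd_conv_nth[of ps] by fastforce
    next
      case 2
      then show ?thesis using mid by blast
    next
      case 3
      then show ?thesis using last len uv last_conv_nth[of ps] by fastforce
    qed
  qed
  then obtain g where g: "\<And>i. i < length ps \<Longrightarrow> g i \<in> V \<and> ps ! i = indicator {g i}"
    by metis
  define xs where "xs = map g [0..<length ps]"
  have es: "es ! i = {g i, g (Suc i)} \<and> g i \<noteq> g (Suc i)" if i: "i < length es" for i
  proof -
    have E: "es ! i \<in> E" and p: "ps ! i = indicator {g i}" "ps ! Suc i = indicator {g (Suc i)}"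
      using pieces[OF i] g i len by auto
    have "finite (es ! i)" using edges[OF E] card.infinite by fastforce
    then have "g i \<in> es ! i" "g (Suc i) \<in> es ! i"
      using pieces[OF i] unfolding p by (auto simp: indicator_in_cell_iff)
    moreover have "g i \<noteq> g (Suc i)" using pieces[OF i] unfolding p by auto
    ultimately show ?thesis using edge_eq_ends[OF E] by blast
  qed
  have neq: "ps ! i \<noteq> ps ! j" if ij: "i < j" "j < length ps" for i j
  proof
    assume eq: "ps ! i = ps ! j"
    then have jS: "j \<noteq> Suc i" using pieces[of i] ij len by auto
    \<comment> \<open>The breakpoint \<open>j\<close> starts piece \<open>j\<close>, except that the last one ends piece \<open>j - 1\<close>.\<close>
    define k where "k = (if j < length es then j else j - 1)"
    have k: "i < k" "k < length es" "ps ! j \<in> segment (ps ! k) (ps ! Suc k)"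
      using ij jS len ends_in_segment by (auto simp: k_def)
    have "ps ! i \<in> segment (ps ! i) (ps ! Suc i) \<inter> segment (ps ! k) (ps ! Suc k)"
      using k(3) eq ends_in_segment by auto
    then have "k = Suc i \<and> ps ! i = ps ! k" using inter[OF k(1,2)] by (auto split: if_splits)
    then show False using pieces[of i] k by auto
  qed
  have "distinct xs"
    unfolding distinct_conv_nth xs_def
  proof (intro allI impI)
    fix i j assume "i < length (map g [0..<length ps])" "j < length (map g [0..<length ps])" "i \<noteq> j"
    then show "map g [0..<length ps] ! i \<noteq> map g [0..<length ps] ! j"
      using neq[of i j] neq[of j i] g[of i] g[of j] by (cases i j rule: linorder_cases) auto
  qed
  moreover have "is_walk V E xs"
    unfolding is_walk_def successively_conv_nth
  proof (intro conjI allI impI)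
    show "xs \<noteq> []" using len by (simp add: xs_def)
    show "set xs \<subseteq> V" using g by (auto simp: xs_def)
    fix i assume "Suc i < length xs"
    then show "{xs ! i, xs ! Suc i} \<in> E"
      using es[of i] pieces[of i] len by (simp add: xs_def del: upt_Suc)
  qed
  moreover have "hd xs = u"
  proof -
    have "ps ! 0 = indicator {u}" using hd len hd_conv_nth[of ps] by fastforce
    then have "(indicator {g 0} :: 'v \<Rightarrow> real) = indicator {u}" using g[of 0] len by auto
    then show ?thesis
      using len by (simp add: xs_def hd_conv_nth indicator_singleton_eq_iff del: upt_Suc)
  qed
  moreover have "last xs = v"
  proof -
    have "ps ! length es = indicator {v}" using last len last_conv_nth[of ps] by fastforce
    then have "(indicator {g (length es)} :: 'v \<Rightarrow> real) = indicator {v}"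
      using g[of "length es"] len by auto
    then show ?thesis
      using len by (simp add: xs_def last_conv_nth indicator_singleton_eq_iff del: upt_Suc)
  qed
  moreover have "path_length w ps es = walk_length w xs"
    unfolding path_length_def walk_length_eq_sum
  proof (rule sum.cong)
    show "{..<length es} = {..<length xs - 1}" by (simp add: xs_def len)
    fix i assume "i \<in> {..<length xs - 1}"
    then have i: "i < length es" by (simp add: xs_def len)
    then show "edge_length w (es ! i) (ps ! i) (ps ! Suc i) = w {xs ! i, xs ! Suc i}"
      using es[OF i] g[of i] g[of "Suc i"] edge_length_ends[of "g i" "g (Suc i)" w] len
      by (simp add: xs_def del: upt_Suc)
  qed
  ultimately show ?thesis by blast
qed

lemma tree_dist_eq_walk_length:
  assumes "is_walk V E xs" "distinct xs"
  shows "tree_dist V E w (indicator {hd xs}) (indicator {last xs}) = walk_length w xs"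
  unfolding tree_dist_def
proof (rule the_equality)
  show "\<exists>ps es. is_simple_path V E (indicator {hd xs}) (indicator {last xs}) ps es
      \<and> walk_length w xs = path_length w ps es"
    using distinct_walk_is_simple_path[OF assms] by metis
next
  fix l
  assume "\<exists>ps es. is_simple_path V E (indicator {hd xs}) (indicator {last xs}) ps es
      \<and> l = path_length w ps es"
  moreover have "hd xs \<in> V" "last xs \<in> V" using assms(1) unfolding is_walk_def by auto
  ultimately obtain ys where
    "is_walk V E ys" "distinct ys" "hd ys = hd xs" "last ys = last xs" "l = walk_length w ys"
    using simple_path_between_vertices by metis
  then show "l = walk_length w xs"
    using distinct_walk_unique[OF acyclic] assms by metis
qed

lemma tree_dist_edge:
  assumes "{x, y} \<in> E"
  shows "tree_dist V E w (indicator {x}) (indicator {y}) = w {x, y}"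
  using tree_dist_eq_walk_length[of "[x, y]"] edge_ends[OF assms] assms by (simp add: is_walk_def)

section \<open>Leaves\<close>

lemma leaf_unique_neighbour:
  assumes "u \<in> leaves V E"
  shows "\<exists>a. {u, a} \<in> E \<and> (\<forall>x. {u, x} \<in> E \<longrightarrow> x = a)"
proof -
  have "card {e \<in> E. u \<in> e} = 1"
    using assms by (simp add: leaves_def degree_def)
  then obtain e where e: "{e \<in> E. u \<in> e} = {e}" by (rule card_1_singletonE)
  then have "e \<in> E" "u \<in> e" by auto
  with edges[of e] obtain a where a: "e = {u, a}" by (auto simp: card_2_iff)
  have "x = a" if "{u, x} \<in> E" for x
  proof -
    have "{u, x} \<in> {e \<in> E. u \<in> e}" using that by simp
    then have "{u, x} = {u, a}" unfolding e a by simp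
    then show ?thesis by (metis doubleton_eq_iff)
  qed
  then show ?thesis using \<open>e \<in> E\<close> a by blast
qed

lemma dist_between_leaves:
  assumes u: "u \<in> V" "{u, a} \<in> E" "\<And>x. {u, x} \<in> E \<Longrightarrow> x = a"
    and v: "v \<in> V" "{v, b} \<in> E" "\<And>x. {v, x} \<in> E \<Longrightarrow> x = b"
    and "u \<noteq> v" "a \<noteq> v"
  shows "tree_dist V E w (indicator {u}) (indicator {v}) =
    tree_dist V E w (indicator {u}) (indicator {a}) +
    tree_dist V E w (indicator {a}) (indicator {b}) +
    tree_dist V E w (indicator {b}) (indicator {v})"
proof -
  obtain xs where xs: "is_walk V E xs" "distinct xs" "hd xs = u" "last xs = v"
    using distinct_walk_exists connected[OF u(1) v(1)] by metis
  then obtain xs' where xs': "xs = u # xs'"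
    by (cases xs) (auto simp: is_walk_def)
  moreover have "xs' \<noteq> []" using xs(4) \<open>u \<noteq> v\<close> xs' by auto
  ultimately obtain ys where ys: "xs = u # ys @ [v]"
    using xs(4) by (metis append_butlast_last_id last_ConsR)
  have succ: "successively (\<lambda>x y. {x, y} \<in> E) (u # ys @ [v])" and sub: "set ys \<subseteq> V"
    using xs(1) unfolding is_walk_def ys by auto
  have "ys \<noteq> []" using succ u(3) \<open>a \<noteq> v\<close> by auto
  then have edges': "{u, hd ys} \<in> E" "{v, last ys} \<in> E"
    and walk: "is_walk V E ys"
    using succ sub by (auto simp: successively_Cons successively_append_iff is_walk_def insert_commute)
  have a: "hd ys = a" and b: "last ys = b" using edges' u(3) v(3) by auto
  have "tree_dist V E w (indicator {u}) (indicator {v}) = walk_length w xs"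
    using tree_dist_eq_walk_length[OF xs(1,2)] xs(3,4) by simp
  also have "\<dots> = w {u, a} + walk_length w ys + w {b, v}"
    using \<open>ys \<noteq> []\<close> a b by (simp add: ys walk_length_Cons walk_length_snoc hd_append)
  also have "walk_length w ys = tree_dist V E w (indicator {a}) (indicator {b})"
    using tree_dist_eq_walk_length[OF walk] xs(2) a b by (simp add: ys)
  finally show ?thesis
    using tree_dist_edge[OF u(2)] tree_dist_edge[of b v] v(2) by (simp add: insert_commute)
qed

end

section \<open>The labelling of leaves\<close>

lemma d1_additive_coordinatewise:
  fixes p q r s :: "real ^ 'n"
  assumes "d1 p s = d1 p q + d1 q r + d1 r s"
  shows "\<bar>p $ i - s $ i\<bar> = \<bar>p $ i - q $ i\<bar> + \<bar>q $ i - r $ i\<bar> + \<bar>r $ i - s $ i\<bar>"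
proof -
  let ?gap = "\<lambda>i. \<bar>p $ i - q $ i\<bar> + \<bar>q $ i - r $ i\<bar> + \<bar>r $ i - s $ i\<bar> - \<bar>p $ i - s $ i\<bar>"
  \<comment> \<open>Nonnegative defects of the coordinatewise triangle inequality that sum to 0.\<close>
  have "(\<Sum>i\<in>UNIV. ?gap i) = 0"
    using assms unfolding d1_def by (simp add: sum.distrib sum_subtractf)
  moreover have "\<forall>i\<in>UNIV. 0 \<le> ?gap i" by auto
  ultimately have "?gap i = 0"
    by (subst (asm) sum_nonneg_eq_0_iff) auto
  then show ?thesis by simp
qed

theorem proposition4p5:
  fixes V :: "'v set" and E :: "'v set set" and w :: "'v set \<Rightarrow> real"
  assumes "finite_weighted_tree V E w"
    and "card (leaves V E) > 2 * CARD('n::finite)"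
  shows "\<nexists>f :: ('v \<Rightarrow> real) \<Rightarrow> real ^ 'n.
           isometric_embedding_on (realization V E) (tree_dist V E w) d1 f"
proof
  interpret finite_weighted_tree V E w by fact
  assume "\<exists>f :: ('v \<Rightarrow> real) \<Rightarrow> real ^ 'n.
           isometric_embedding_on (realization V E) (tree_dist V E w) d1 f"
  then obtain f :: "('v \<Rightarrow> real) \<Rightarrow> real ^ 'n"
    where f: "isometric_embedding_on (realization V E) (tree_dist V E w) d1 f" ..
  define h where "h x = f (indicator {x})" for x :: 'v
  have h: "d1 (h x) (h y) = tree_dist V E w (indicator {x}) (indicator {y})"
    if "x \<in> V" "y \<in> V" for x y
    using f vertex_in_realization[OF that(1)] vertex_in_realization[OF that(2)]
    unfolding isometric_embedding_on_def h_def by blast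
  obtain nb where nb: "\<And>u. u \<in> leaves V E \<Longrightarrow> {u, nb u} \<in> E"
    "\<And>u x. u \<in> leaves V E \<Longrightarrow> {u, x} \<in> E \<Longrightarrow> x = nb u"
    using leaf_unique_neighbour by metis
  have V: "u \<in> V" "nb u \<in> V" if "u \<in> leaves V E" for u
    using edge_ends[OF nb(1)[OF that]] by auto
  have "\<exists>i. h u $ i \<noteq> h (nb u) $ i" if u: "u \<in> leaves V E" for u
  proof (rule ccontr)
    assume "\<nexists>i. h u $ i \<noteq> h (nb u) $ i"
    then have "d1 (h u) (h (nb u)) = 0" unfolding d1_def by simp
    then show False
      using h V[OF u] tree_dist_edge[OF nb(1)[OF u]] weight_pos[OF nb(1)[OF u]] by simp
  qed
  then obtain c where c: "\<And>u. u \<in> leaves V E \<Longrightarrow> h u $ c u \<noteq> h (nb u) $ c u"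
    by metis
  define label where "label u = (c u, h (nb u) $ c u < h u $ c u)" for u
  have "inj_on label (leaves V E)"
  proof (rule inj_onI, rule ccontr)
    fix u v
    assume u: "u \<in> leaves V E" and v: "v \<in> leaves V E" and eq: "label u = label v" and "u \<noteq> v"
    define i where "i = c u"
    have ui: "h u $ i \<noteq> h (nb u) $ i" and vi: "h v $ i \<noteq> h (nb v) $ i"
      and same: "h (nb u) $ i < h u $ i \<longleftrightarrow> h (nb v) $ i < h v $ i"
      using c[OF u] c[OF v] eq by (auto simp: label_def i_def)
    show False
    proof (cases "nb u = v")
      case True
      \<comment> \<open>Here \<open>u\<close> and \<open>v\<close> are the ends of a single edge, so its change has opposite signs seen
          from them.\<close>
      then have "nb v = u" using nb(1)[OF u] nb(2)[OF v, of u] by (simp add: insert_commute)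
      then show False using True ui same by auto
    next
      case False
      have "d1 (h u) (h v) = d1 (h u) (h (nb u)) + d1 (h (nb u)) (h (nb v)) + d1 (h (nb v)) (h v)"
        using dist_between_leaves[OF V(1)[OF u] nb(1)[OF u] nb(2)[OF u]
            V(1)[OF v] nb(1)[OF v] nb(2)[OF v] \<open>u \<noteq> v\<close> False]
        by (simp add: h V[OF u] V[OF v])
      from d1_additive_coordinatewise[OF this, of i] show False
        using ui vi same by linarith
    qed
  qed
  then have "card (leaves V E) \<le> card (UNIV :: ('n \<times> bool) set)"
    by (rule card_inj_on_le) auto
  also have "\<dots> = 2 * CARD('n)"
    by (simp add: card_prod)
  finally show False using assms(2) by simp
qed

end
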